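(* Let $S\subset\mathbb{R}^d$ be compact. Then every $S$-valued polynomial process $X=(X_t)_{0\le t\le T}$ is a Feller process, i.e. its transition operators $(P_{s,t})_{(s,t)\in\Delta}$ are Feller.
   Context: Fix $T>0$ and let $\Delta=\{(s,t):0\le s\le t\le T\}$. $S$ carries its Borel $\sigma$-algebra $\mathcal{S}$. Transition operators $(P_{s,t})_{(s,t)\in\Delta}$ are given by $P_{s,t}f(x)=\int_S f(\xi)\,p_{s,t}(x,d\xi)$, where $p$ is a transition probability function: $p_{s,t}(x,A)$ is jointly measurable in $(s,t,x)$ for each $A\in\mathcal{S}$; $p_{s,t}(x,\cdot)$ is a probability measure on $\mathcal{S}$; $p_{t,t}(x,\cdot)=\delta_x$; and $p_{s,u}(x,A)=\int_S p_{s,t}(x,dy)\,p_{t,u}(y,A)$ for $0\le s\le t\le u\le T$. For a multi-index $\mathbf{k}\in\mathbb{N}_0^d$ write $|\mathbf{k}|=k_1+\dots+k_d$ and $x^{\mathbf{k}}=x_1^{k_1}\cdots x_d^{k_d}$. $\mathscr{P}_k(S)$ is the space of functions $S\ni x\mapsto\sum_{|\mathbf{l}|=0}^k\alpha_{\mathbf{l}}x^{\mathbf{l}}$ with $\alpha_{\mathbf{l}}\in\mathbb{R}$. $\tilde{\mathscr{P}}_k(S)$ is the space of functions $\Delta\times S\ni(s,t,x)\mapsto\sum_{|\mathbf{l}|=0}^k\alpha_{\mathbf{l}}(s,t)x^{\mathbf{l}}$ with $\alpha_{\mathbf{l}}\in C^1(\Delta,\mathbb{R})$, the once continuously differentiable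 functions $\Delta\to\mathbb{R}$. The transition operators are called $m$-polynomial if for all $k\in\{0,\dots,m\}$ and all $f\in\mathscr{P}_k(S)$ the map $(s,t,x)\mapsto P_{s,t}f(x)$ is in $\tilde{\mathscr{P}}_k(S)$, and polynomial if they are $m$-polynomial for all $m\ge0$. A polynomial process is a càdlàg $S$-valued Markov process whose transition operators are polynomial. $C_0(S)$ is the Banach space, with norm $\|f\|_\infty=\sup_{x\in S}|f(x)|$, of continuous $f:S\to\mathbb{R}$ such that for all $\varepsilon>0$ there is a compact $K\subset S$ with $|f(x)|<\varepsilon$ for $x\notin K$. Transition operators are called Feller if for all $f\in C_0(S)$: (i) $P_{s,t}f\in C_0(S)$ for all $(s,t)\in\Delta$; (ii) $\|P_{s,t}f\|_\infty\le\|f\|_\infty$ for all $(s,t)\in\Delta$; (iii) $(P_{s,t})$ is strongly continuous on $(C_0(S),\|\cdot\|_\infty)$, i.e. $\lim_{\Delta\ni(v,w)\to(s,t)}\|P_{v,w}f-P_{s,t}f\|_\infty=0$ for every $(s,t)\in\Delta$. *)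

theory Defs
  imports "HOL-Probability.Probability"
begin

definition time_simplex :: "real \<Rightarrow> (real \<times> real) set" where
  "time_simplex T = {(s, t). 0 \<le> s \<and> s \<le> t \<and> t \<le> T}"

text \<open>Functions on \<open>S\<close> are represented by total functions on \<^typ>\<open>real ^ 'd\<close>; every
  notion below depends only on their values on \<open>S\<close>. Likewise all objects indexed by time are
  constrained only for times in \<open>[0, T]\<close>.\<close>

definition transition_function ::
  "real \<Rightarrow> (real ^ 'd::finite) set \<Rightarrow> (real \<Rightarrow> real \<Rightarrow> real ^ 'd \<Rightarrow> (real ^ 'd) measure) \<Rightarrow> bool"
where
  "transition_function T S p \<longleftrightarrow>
     (\<forall>(s, t) \<in> time_simplex T. \<forall>x \<in> S.
        sets (p s t x) = sets (restrict_space borel S) \<and> prob_space (p s t x)) \<and>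
     (\<forall>A \<in> sets (restrict_space borel S).
        (\<lambda>((s, t), x). measure (p s t x) A)
          \<in> borel_measurable (restrict_space borel (time_simplex T \<times> S))) \<and>
     (\<forall>t \<in> {0..T}. \<forall>x \<in> S. p t t x = return (restrict_space borel S) x) \<and>
     (\<forall>s t u. 0 \<le> s \<and> s \<le> t \<and> t \<le> u \<and> u \<le> T \<longrightarrow>
        (\<forall>x \<in> S. \<forall>A \<in> sets (restrict_space borel S).
           measure (p s u x) A = (\<integral>y. measure (p t u y) A \<partial>(p s t x))))"

definition transition_op ::
  "(real \<Rightarrow> real \<Rightarrow> 'x \<Rightarrow> 'x measure) \<Rightarrow> real \<Rightarrow> real \<Rightarrow> ('x \<Rightarrow> real) \<Rightarrow> 'x \<Rightarrow> real"
where
  "transition_op p s t f x = (\<integral>\<xi>. f \<xi> \<partial>(p s t x))"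

definition multi_degree :: "nat ^ 'd::finite \<Rightarrow> nat" where
  "multi_degree l = (\<Sum>i\<in>UNIV. l $ i)"

definition monomial :: "nat ^ 'd::finite \<Rightarrow> real ^ 'd \<Rightarrow> real" where
  "monomial l x = (\<Prod>i\<in>UNIV. (x $ i) ^ (l $ i))"

definition polynomials :: "nat \<Rightarrow> (real ^ 'd::finite) set \<Rightarrow> (real ^ 'd \<Rightarrow> real) set" where
  "polynomials k S =
     {f. \<exists>\<alpha>. \<forall>x \<in> S. f x = (\<Sum>l | multi_degree l \<le> k. \<alpha> l * monomial l x)}"

text \<open>Continuous differentiability on a closed set, with one-sided derivatives at the boundary.
  On the simplex with \<open>T > 0\<close> (convex, with nonempty interior) derivatives within
  the set are unique.\<close>

definition C1_on :: "(real \<times> real) set \<Rightarrow> (real \<times> real \<Rightarrow> real) \<Rightarrow> bool" where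
  "C1_on D a \<longleftrightarrow>
     (\<exists>a' :: real \<times> real \<Rightarrow> (real \<times> real) \<Rightarrow>\<^sub>L real. continuous_on D a' \<and>
        (\<forall>z \<in> D. (a has_derivative blinfun_apply (a' z)) (at z within D)))"

definition time_polynomials ::
  "real \<Rightarrow> nat \<Rightarrow> (real ^ 'd::finite) set \<Rightarrow> (real \<Rightarrow> real \<Rightarrow> real ^ 'd \<Rightarrow> real) set"
where
  "time_polynomials T k S =
     {g. \<exists>\<alpha>. (\<forall>l. multi_degree l \<le> k \<longrightarrow> C1_on (time_simplex T) (\<alpha> l)) \<and>
        (\<forall>(s, t) \<in> time_simplex T. \<forall>x \<in> S.
           g s t x = (\<Sum>l | multi_degree l \<le> k. \<alpha> l (s, t) * monomial l x))}"

text \<open>The integrability clause says that \<open>P\<^sub>s\<^sub>,\<^sub>t f (x)\<close> is well defined: the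
  Bochner integral of a non-integrable function is \<open>0\<close> by convention. It holds automatically when
  \<open>S\<close> is bounded.\<close>

definition m_polynomial_transition ::
  "real \<Rightarrow> (real ^ 'd::finite) set \<Rightarrow> nat \<Rightarrow> (real \<Rightarrow> real \<Rightarrow> real ^ 'd \<Rightarrow> (real ^ 'd) measure) \<Rightarrow> bool"
where
  "m_polynomial_transition T S m p \<longleftrightarrow>
     (\<forall>k \<le> m. \<forall>f \<in> polynomials k S.
        (\<forall>(s, t) \<in> time_simplex T. \<forall>x \<in> S. integrable (p s t x) f) \<and>
        (\<lambda>s t. transition_op p s t f) \<in> time_polynomials T k S)"

definition polynomial_transition ::
  "real \<Rightarrow> (real ^ 'd::finite) set \<Rightarrow> (real \<Rightarrow> real \<Rightarrow> real ^ 'd \<Rightarrow> (real ^ 'd) measure) \<Rightarrow> bool"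
where
  "polynomial_transition T S p \<longleftrightarrow> (\<forall>m. m_polynomial_transition T S m p)"

definition cadlag_on :: "real \<Rightarrow> (real ^ 'd::finite) set \<Rightarrow> (real \<Rightarrow> real ^ 'd) \<Rightarrow> bool" where
  "cadlag_on T S g \<longleftrightarrow>
     (\<forall>t. 0 \<le> t \<and> t < T \<longrightarrow> (g \<longlongrightarrow> g t) (at_right t)) \<and>
     (\<forall>t. 0 < t \<and> t \<le> T \<longrightarrow> (\<exists>l \<in> S. (g \<longlongrightarrow> l) (at_left t)))"

definition filtration_on :: "real \<Rightarrow> 'w measure \<Rightarrow> (real \<Rightarrow> 'w measure) \<Rightarrow> bool" where
  "filtration_on T M F \<longleftrightarrow>
     (\<forall>t \<in> {0..T}. subalgebra M (F t)) \<and>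
     (\<forall>s t. 0 \<le> s \<and> s \<le> t \<and> t \<le> T \<longrightarrow> subalgebra (F t) (F s))"

definition markov_process ::
  "real \<Rightarrow> (real ^ 'd::finite) set \<Rightarrow> (real \<Rightarrow> real \<Rightarrow> real ^ 'd \<Rightarrow> (real ^ 'd) measure) \<Rightarrow>
   'w measure \<Rightarrow> (real \<Rightarrow> 'w measure) \<Rightarrow> (real \<Rightarrow> 'w \<Rightarrow> real ^ 'd) \<Rightarrow> bool"
where
  "markov_process T S p M F X \<longleftrightarrow>
     prob_space M \<and> filtration_on T M F \<and> transition_function T S p \<and>
     (\<forall>t \<in> {0..T}. X t \<in> measurable (F t) (restrict_space borel S)) \<and>
     (\<forall>(s, t) \<in> time_simplex T. \<forall>f \<in> borel_measurable (restrict_space borel S).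
        bounded (f ` S) \<longrightarrow>
        (AE \<omega> in M. real_cond_exp M (F s) (\<lambda>\<omega>. f (X t \<omega>)) \<omega> = transition_op p s t f (X s \<omega>)))"

definition polynomial_process ::
  "real \<Rightarrow> (real ^ 'd::finite) set \<Rightarrow> (real \<Rightarrow> real \<Rightarrow> real ^ 'd \<Rightarrow> (real ^ 'd) measure) \<Rightarrow>
   'w measure \<Rightarrow> (real \<Rightarrow> 'w measure) \<Rightarrow> (real \<Rightarrow> 'w \<Rightarrow> real ^ 'd) \<Rightarrow> bool"
where
  "polynomial_process T S p M F X \<longleftrightarrow>
     markov_process T S p M F X \<and>
     (\<forall>\<omega> \<in> space M. cadlag_on T S (\<lambda>t. X t \<omega>)) \<and>
     polynomial_transition T S p"

definition C0_space :: "'x::topological_space set \<Rightarrow> ('x \<Rightarrow> real) set" where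
  "C0_space S =
     {f. continuous_on S f \<and>
        (\<forall>\<epsilon>>0. \<exists>K. compact K \<and> K \<subseteq> S \<and> (\<forall>x \<in> S - K. \<bar>f x\<bar> < \<epsilon>))}"

text \<open>Meaningful for functions that are bounded on a nonempty \<open>S\<close>, in particular
  for elements of \<^const>\<open>C0_space\<close> and their differences.\<close>

definition sup_norm_on :: "'x set \<Rightarrow> ('x \<Rightarrow> real) \<Rightarrow> real" where
  "sup_norm_on S f = (SUP x\<in>S. \<bar>f x\<bar>)"

definition feller ::
  "real \<Rightarrow> 'x::topological_space set \<Rightarrow> (real \<Rightarrow> real \<Rightarrow> ('x \<Rightarrow> real) \<Rightarrow> 'x \<Rightarrow> real) \<Rightarrow> bool"
where
  "feller T S P \<longleftrightarrow>
     (\<forall>f \<in> C0_space S.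
        (\<forall>(s, t) \<in> time_simplex T. P s t f \<in> C0_space S) \<and>
        (\<forall>(s, t) \<in> time_simplex T. sup_norm_on S (P s t f) \<le> sup_norm_on S f) \<and>
        (\<forall>(s, t) \<in> time_simplex T.
           ((\<lambda>(v, w). sup_norm_on S (\<lambda>x. P v w f x - P s t f x)) \<longlongrightarrow> 0)
             (at (s, t) within time_simplex T)))"

end

theory Submission imports Defs begin

text \<open>By Stone--Weierstrass the polynomials are uniformly dense in the continuous functions on
  the compact set \<open>S\<close>, and every \<open>P\<^sub>s\<^sub>,\<^sub>t\<close> is a contraction for the supremum norm on \<open>S\<close>. Hence
  both continuity claims pass from polynomials to continuous functions by uniform approximation;
  for polynomials they are immediate because the coefficients of \<open>P\<^sub>s\<^sub>,\<^sub>t f\<close> are continuous in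
  \<open>(s, t)\<close> and monomials are bounded on \<open>S\<close>.\<close>

section \<open>The algebra of polynomial functions on \<open>S\<close>\<close>

lemma finite_multi_degree_le: "finite {l :: nat ^ 'd::finite. multi_degree l \<le> k}"
proof (rule finite_subset)
  \<comment> \<open>Multi-indices are read as functions into \<open>{..k}\<close>, of which there
    are finitely many; this box suffices because each component is at most the total degree.\<close>
  show "finite (vec_lambda ` (UNIV \<rightarrow>\<^sub>E {..k}) :: (nat ^ 'd) set)"
    by (intro finite_imageI finite_PiE) auto
  show "{l :: nat ^ 'd. multi_degree l \<le> k} \<subseteq> vec_lambda ` (UNIV \<rightarrow>\<^sub>E {..k})"
  proof
    fix l :: "nat ^ 'd" assume "l \<in> {l. multi_degree l \<le> k}"
    then have "l $ i \<le> k" for i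
      using member_le_sum[of i UNIV "\<lambda>i. l $ i"] by (auto simp: multi_degree_def)
    then have "vec_nth l \<in> UNIV \<rightarrow>\<^sub>E {..k}" by auto
    moreover have "l = vec_lambda (vec_nth l)" by simp
    ultimately show "l \<in> vec_lambda ` (UNIV \<rightarrow>\<^sub>E {..k})" by blast
  qed
qed

text \<open>Padding the coefficients with zeros brings two polynomials to a common degree before
  they are added.\<close>

lemma polynomials_mono:
  assumes "j \<le> k"
  shows "polynomials j S \<subseteq> polynomials k S"
proof
  fix f assume "f \<in> polynomials j S"
  then obtain \<alpha> where \<alpha>: "\<And>x. x \<in> S \<Longrightarrow> f x = (\<Sum>l | multi_degree l \<le> j. \<alpha> l * monomial l x)"
    by (auto simp: polynomials_def)
  have "f x = (\<Sum>l | multi_degree l \<le> k. (if multi_degree l \<le> j then \<alpha> l else 0) * monomial l x)"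
    if "x \<in> S" for x
    unfolding \<alpha>[OF that]
    using assms by (intro sum.mono_neutral_cong_left finite_multi_degree_le) auto
  then show "f \<in> polynomials k S"
    unfolding polynomials_def by (intro CollectI exI ballI)
qed

lemma polynomials_add:
  assumes "f \<in> polynomials j S" "g \<in> polynomials k S"
  shows "(\<lambda>x. f x + g x) \<in> polynomials (max j k) S"
proof -
  have "f \<in> polynomials (max j k) S" "g \<in> polynomials (max j k) S"
    using assms polynomials_mono[of j "max j k" S] polynomials_mono[of k "max j k" S] by auto
  then obtain \<alpha> \<beta> where
    "\<And>x. x \<in> S \<Longrightarrow> f x = (\<Sum>l | multi_degree l \<le> max j k. \<alpha> l * monomial l x)"
    "\<And>x. x \<in> S \<Longrightarrow> g x = (\<Sum>l | multi_degree l \<le> max j k. \<beta> l * monomial l x)"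
    by (auto simp: polynomials_def)
  then have "\<forall>x\<in>S. f x + g x = (\<Sum>l | multi_degree l \<le> max j k. (\<alpha> l + \<beta> l) * monomial l x)"
    by (simp add: distrib_right sum.distrib)
  then show ?thesis
    unfolding polynomials_def by (intro CollectI exI)
qed

lemma polynomials_monomial: "(\<lambda>x. c * monomial l x) \<in> polynomials (multi_degree l) S"
proof -
  have "(\<Sum>m | multi_degree m \<le> multi_degree l. (if m = l then c else 0) * monomial m x)
      = c * monomial l x" for x
    by (simp add: if_distrib[of "\<lambda>a. a * _"] sum.delta finite_multi_degree_le cong: if_cong)
  then have "\<forall>x\<in>S. c * monomial l x =
      (\<Sum>m | multi_degree m \<le> multi_degree l. (if m = l then c else 0) * monomial m x)"
    by simp
  then show ?thesis
    unfolding polynomials_def by (intro CollectI exI)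
qed

lemma polynomials_const: "(\<lambda>x. c) \<in> polynomials 0 S"
  using polynomials_monomial[of c 0 S] by (simp add: monomial_def multi_degree_def)

lemma polynomials_sum:
  assumes "finite I" "\<And>i. i \<in> I \<Longrightarrow> \<exists>k. f i \<in> polynomials k S"
  shows "\<exists>k. (\<lambda>x. \<Sum>i\<in>I. f i x) \<in> polynomials k S"
  using assms
proof (induction I rule: finite_induct)
  case empty
  then show ?case using polynomials_const[of 0 S] by auto
next
  case (insert i I)
  then obtain j k where "f i \<in> polynomials j S" "(\<lambda>x. \<Sum>i\<in>I. f i x) \<in> polynomials k S"
    by blast
  then have "(\<lambda>x. f i x + (\<Sum>i\<in>I. f i x)) \<in> polynomials (max j k) S"
    by (rule polynomials_add)
  then show ?case using insert.hyps by auto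
qed

lemma polynomials_cong:
  assumes "f \<in> polynomials k S" "\<And>x. x \<in> S \<Longrightarrow> g x = f x"
  shows "g \<in> polynomials k S"
  using assms by (auto simp: polynomials_def)

lemma monomial_mult: "monomial l x * monomial m x = monomial (l + m) x"
  by (simp add: monomial_def power_add prod.distrib)

text \<open>Expanding the product gives a finite double sum of monomials with exponents
  \<open>l + m\<close>, so closure under sums applies. The degree stays existential because density
  asks only for some degree.\<close>

lemma polynomials_mult:
  assumes "f \<in> polynomials j S" "g \<in> polynomials k S"
  shows "\<exists>n. (\<lambda>x. f x * g x) \<in> polynomials n S"
proof -
  obtain \<alpha> \<beta> where
    f: "\<And>x. x \<in> S \<Longrightarrow> f x = (\<Sum>l | multi_degree l \<le> j. \<alpha> l * monomial l x)" and
    g: "\<And>x. x \<in> S \<Longrightarrow> g x = (\<Sum>l | multi_degree l \<le> k. \<beta> l * monomial l x)"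
    using assms by (auto simp: polynomials_def)
  have "\<exists>n. (\<lambda>x. \<Sum>l | multi_degree l \<le> j. \<Sum>m | multi_degree m \<le> k.
      (\<alpha> l * \<beta> m) * monomial (l + m) x) \<in> polynomials n S"
    by (intro polynomials_sum finite_multi_degree_le) (rule exI, rule polynomials_monomial)
  then obtain n where n: "(\<lambda>x. \<Sum>l | multi_degree l \<le> j. \<Sum>m | multi_degree m \<le> k.
      (\<alpha> l * \<beta> m) * monomial (l + m) x) \<in> polynomials n S"
    by blast
  have "(\<lambda>x. f x * g x) \<in> polynomials n S"
    by (rule polynomials_cong[OF n])
      (simp add: f g sum_product monomial_mult[symmetric] mult_ac)
  then show ?thesis ..
qed

lemma polynomials_component: "(\<lambda>x. c * x $ i) \<in> polynomials 1 S"
proof -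
  \<comment> \<open>\<open>axis i 1\<close> is the i-th unit multi-index: all other exponents are 0,
    and those factors equal 1 even where the coordinate vanishes.\<close>
  have "monomial (axis i 1) x = x $ i" for x :: "real ^ 'a"
    by (simp add: monomial_def axis_def if_distrib[of "\<lambda>n. _ ^ n"] prod.delta cong: if_cong)
  moreover have "multi_degree (axis i 1 :: nat ^ 'a) = 1"
    by (simp add: multi_degree_def axis_def)
  ultimately show ?thesis
    using polynomials_monomial[of c "axis i 1" S] by simp
qed

section \<open>Density of the polynomials in the continuous functions\<close>

text \<open>\<open>real_polynomial_function\<close> is generated from bounded linear maps and
  constants by sums and products. Induction over these rules carries the class used by
  Stone-Weierstrass over to explicit monomial coefficients.\<close>

lemma real_polynomial_function_polynomials:
  fixes f :: "real ^ 'd::finite \<Rightarrow> real"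
  assumes "real_polynomial_function f"
  shows "\<exists>k. f \<in> polynomials k S"
  using assms
proof induction
  case (linear f)
  then interpret bounded_linear f .
  \<comment> \<open>A linear functional is determined by its values on the unit vectors; these
    become the coefficients of the degree-one monomials.\<close>
  have "f x = (\<Sum>i\<in>UNIV. f (axis i 1) * x $ i)" for x
    by (subst basis_expansion[symmetric])
      (simp add: sum scale scalar_mult_eq_scaleR mult.commute)
  moreover have "\<exists>k. (\<lambda>x. \<Sum>i\<in>UNIV. f (axis i 1) * x $ i) \<in> polynomials k S"
    by (intro polynomials_sum finite) (rule exI, rule polynomials_component)
  ultimately show ?case
    by (metis (no_types, lifting) polynomials_cong)
qed (blast intro: polynomials_const polynomials_add polynomials_mult)+

lemma polynomials_dense:
  fixes S :: "(real ^ 'd::finite) set"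
  assumes "compact S" "continuous_on S f" "e > 0"
  obtains g k where "g \<in> polynomials k S" "\<And>x. x \<in> S \<Longrightarrow> \<bar>f x - g x\<bar> < e"
proof -
  obtain g where "real_polynomial_function g" "\<And>x. x \<in> S \<Longrightarrow> \<bar>f x - g x\<bar> < e"
    using Stone_Weierstrass_real_polynomial_function[OF assms] by blast
  with real_polynomial_function_polynomials[of g S] that show ?thesis by blast
qed

section \<open>Continuity in space and time\<close>

lemma continuous_on_monomial: "continuous_on S (monomial l)"
  unfolding monomial_def by (intro continuous_intros)

lemma continuous_on_time_polynomial:
  assumes "g \<in> time_polynomials T k S" "(s, t) \<in> time_simplex T"
  shows "continuous_on S (g s t)"
proof -
  obtain \<alpha> where
    "\<And>x. x \<in> S \<Longrightarrow> g s t x = (\<Sum>l | multi_degree l \<le> k. \<alpha> l (s, t) * monomial l x)"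
    using assms by (auto simp: time_polynomials_def)
  moreover have "continuous_on S (\<lambda>x. \<Sum>l | multi_degree l \<le> k. \<alpha> l (s, t) * monomial l x)"
    by (intro continuous_intros continuous_on_monomial)
  ultimately show ?thesis
    by (simp cong: continuous_on_cong)
qed

text \<open>Approximants with errors 1/(n+1) converge uniformly, and a uniform limit of continuous
  functions is continuous.\<close>

lemma continuous_on_uniform_approx:
  fixes f :: "'a::topological_space \<Rightarrow> real"
  assumes "\<And>e. e > 0 \<Longrightarrow> \<exists>g. continuous_on S g \<and> (\<forall>x\<in>S. \<bar>f x - g x\<bar> \<le> e)"
  shows "continuous_on S f"
proof -
  have "\<exists>g. continuous_on S g \<and> (\<forall>x\<in>S. \<bar>f x - g x\<bar> \<le> inverse (real (Suc n)))" for n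
    by (rule assms) simp
  then obtain g where g: "\<And>n. continuous_on S (g n)"
    "\<And>n x. x \<in> S \<Longrightarrow> \<bar>f x - g n x\<bar> \<le> inverse (real (Suc n))"
    by metis
  have "uniform_limit S g f sequentially"
  proof (rule uniform_limitI)
    fix e :: real assume "e > 0"
    then have "\<forall>\<^sub>F n in sequentially. inverse (real (Suc n)) < e"
      using LIMSEQ_inverse_real_of_nat by (rule order_tendstoD(2)[rotated])
    then show "\<forall>\<^sub>F n in sequentially. \<forall>x\<in>S. dist (g n x) (f x) < e"
    proof eventually_elim
      case (elim n)
      show ?case
        using g(2)[of _ n] elim by (fastforce simp: dist_real_def abs_minus_commute)
    qed
  qed
  then show ?thesis
    using g(1) by (intro uniform_limit_theorem[of _ g]) auto
qed

text \<open>The difference is dominated by the sum of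
  \<open>\<bar>\<alpha> l z - \<alpha> l (s, t)\<bar> * B l\<close>, where \<open>B l\<close> bounds
  the monomial on the compact set. This bound is free of \<open>x\<close> and tends to 0 with the
  finitely many coefficient differences.\<close>

lemma time_polynomials_uniform:
  fixes S :: "(real ^ 'd::finite) set"
  assumes "compact S" "g \<in> time_polynomials T k S" "(s, t) \<in> time_simplex T" "e > 0"
  shows "\<forall>\<^sub>F (v, w) in at (s, t) within time_simplex T. \<forall>x\<in>S. \<bar>g v w x - g s t x\<bar> < e"
proof -
  let ?D = "time_simplex T" and ?L = "{l :: nat ^ 'd. multi_degree l \<le> k}"
  obtain \<alpha> where C1: "\<And>l. l \<in> ?L \<Longrightarrow> C1_on ?D (\<alpha> l)"
    and \<alpha>: "\<And>v w x. (v, w) \<in> ?D \<Longrightarrow> x \<in> S \<Longrightarrow> g v w x = (\<Sum>l\<in>?L. \<alpha> l (v, w) * monomial l x)"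
    using assms(2) unfolding time_polynomials_def by fastforce
  have "\<exists>B. \<forall>x\<in>S. \<bar>monomial l x\<bar> \<le> B" for l
    using compact_imp_bounded[OF compact_continuous_image[OF continuous_on_monomial assms(1)]]
    by (auto simp: bounded_iff)
  then obtain B where B: "\<And>l x. x \<in> S \<Longrightarrow> \<bar>monomial l x\<bar> \<le> B l"
    by metis
  \<comment> \<open>Differentiability within the simplex gives continuity within it, boundary times
    included.\<close>
  have lim: "(\<alpha> l \<longlongrightarrow> \<alpha> l (s, t)) (at (s, t) within ?D)" if "l \<in> ?L" for l
    using C1[OF that] assms(3) has_derivative_continuous
    unfolding C1_on_def continuous_within by blast
  have "((\<lambda>z. \<Sum>l\<in>?L. \<bar>\<alpha> l z - \<alpha> l (s, t)\<bar> * B l)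
      \<longlongrightarrow> (\<Sum>l\<in>?L. \<bar>\<alpha> l (s, t) - \<alpha> l (s, t)\<bar> * B l)) (at (s, t) within ?D)"
    by (intro tendsto_intros lim)
  then have "\<forall>\<^sub>F z in at (s, t) within ?D. (\<Sum>l\<in>?L. \<bar>\<alpha> l z - \<alpha> l (s, t)\<bar> * B l) < e"
    using assms(4) by (intro order_tendstoD(2)) auto
  \<comment> \<open>The coefficient formula for \<open>g v w\<close> is available only at times in
    the simplex.\<close>
  moreover have "\<forall>\<^sub>F z in at (s, t) within ?D. z \<in> ?D"
    by (simp add: eventually_at_filter)
  ultimately show ?thesis
  proof eventually_elim
    case (elim z)
    obtain v w where z: "z = (v, w)" by (cases z)
    have "\<bar>g v w x - g s t x\<bar> < e" if "x \<in> S" for x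
    proof -
      have "\<bar>g v w x - g s t x\<bar> = \<bar>\<Sum>l\<in>?L. (\<alpha> l z - \<alpha> l (s, t)) * monomial l x\<bar>"
        using elim(2) z that assms(3) by (simp add: \<alpha> sum_subtractf left_diff_distrib)
      also have "\<dots> \<le> (\<Sum>l\<in>?L. \<bar>\<alpha> l z - \<alpha> l (s, t)\<bar> * B l)"
        by (rule order_trans[OF sum_abs])
          (auto simp: abs_mult intro!: sum_mono mult_left_mono B that)
      finally show ?thesis using elim(1) by simp
    qed
    then show ?case by (simp add: z)
  qed
qed

section \<open>The supremum norm and \<open>C0_space\<close> on a compact set\<close>

lemma sup_norm_on_le:
  assumes "S \<noteq> {}" "\<And>x. x \<in> S \<Longrightarrow> \<bar>f x\<bar> \<le> c"
  shows "sup_norm_on S f \<le> c"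
  unfolding sup_norm_on_def using assms by (rule cSUP_least)

text \<open>Compactness makes the image bounded above, without which a real \<open>SUP\<close> need
  not dominate its terms.\<close>

lemma abs_le_sup_norm_on:
  fixes f :: "'a::topological_space \<Rightarrow> real"
  assumes "compact S" "continuous_on S f" "x \<in> S"
  shows "\<bar>f x\<bar> \<le> sup_norm_on S f"
  unfolding sup_norm_on_def
proof (rule cSUP_upper[OF assms(3)])
  show "bdd_above ((\<lambda>x. \<bar>f x\<bar>) ` S)"
    using assms(1,2)
    by (intro bounded_imp_bdd_above compact_imp_bounded compact_continuous_image
        continuous_on_rabs)
qed

text \<open>Taking \<open>K = S\<close> makes the smallness condition off \<open>K\<close>
  vacuous.\<close>

lemma C0_space_compact:
  assumes "compact S"
  shows "C0_space S = {f. continuous_on S f}"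
  using assms by (auto simp: C0_space_def intro!: exI[of _ S])

section \<open>Contractivity of the transition operators and the Feller property\<close>

context
  fixes T :: real and S :: "(real ^ 'd::finite) set"
    and p :: "real \<Rightarrow> real \<Rightarrow> real ^ 'd \<Rightarrow> (real ^ 'd) measure"
  assumes compact: "compact S" and transition: "transition_function T S p"
begin

text \<open>Continuity on \<open>S\<close> gives measurability, compactness gives a bound, and
  bounded measurable functions are integrable for a probability measure.\<close>

lemma integrable_transition_function:
  fixes f :: "real ^ 'd \<Rightarrow> real"
  assumes "(s, t) \<in> time_simplex T" "x \<in> S" "continuous_on S f"
  shows "integrable (p s t x) f"
proof -
  have sets: "sets (p s t x) = sets (restrict_space borel S)"
    using transition assms(1,2) by (auto simp: transition_function_def)
  interpret prob_space "p s t x"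
    using transition assms(1,2) by (auto simp: transition_function_def)
  have "f \<in> borel_measurable (p s t x)"
    using borel_measurable_continuous_on_restrict[OF assms(3)]
    by (simp cong: measurable_cong_sets add: sets)
  moreover have "space (p s t x) = S"
    using sets_eq_imp_space_eq[OF sets] by (simp add: space_restrict_space)
  ultimately show ?thesis
    using abs_le_sup_norm_on[OF compact assms(3)]
    by (intro integrable_const_bound[of _ "sup_norm_on S f"]) auto
qed

text \<open>A probability measure averages \<open>\<bar>f\<bar>\<close> to at most \<open>c\<close>.
  The free constant lets one bound serve both for the supremum norm and for approximation
  errors.\<close>

lemma transition_op_le:
  assumes st: "(s, t) \<in> time_simplex T" and x: "x \<in> S"
    and f: "continuous_on S f" and c: "\<And>y. y \<in> S \<Longrightarrow> \<bar>f y\<bar> \<le> c"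
  shows "\<bar>transition_op p s t f x\<bar> \<le> c"
proof -
  have sets: "sets (p s t x) = sets (restrict_space borel S)"
    using transition st x by (auto simp: transition_function_def)
  interpret prob_space "p s t x"
    using transition st x by (auto simp: transition_function_def)
  have "space (p s t x) = S"
    using sets_eq_imp_space_eq[OF sets] by (simp add: space_restrict_space)
  then have "(\<integral>y. \<bar>f y\<bar> \<partial>p s t x) \<le> c"
    using c integrable_transition_function[OF st x f] by (intro integral_le_const) auto
  then show ?thesis
    unfolding transition_op_def using integral_abs_bound[of "p s t x" f] by linarith
qed

lemma transition_op_diff_le:
  assumes st: "(s, t) \<in> time_simplex T" and x: "x \<in> S"
    and f: "continuous_on S f" and g: "continuous_on S g"
    and c: "\<And>y. y \<in> S \<Longrightarrow> \<bar>f y - g y\<bar> \<le> c"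
  shows "\<bar>transition_op p s t f x - transition_op p s t g x\<bar> \<le> c"
proof -
  have "transition_op p s t f x - transition_op p s t g x = transition_op p s t (\<lambda>y. f y - g y) x"
    unfolding transition_op_def
    by (simp add: integrable_transition_function[OF st x] f g)
  also have "\<bar>\<dots>\<bar> \<le> c"
    by (intro transition_op_le st x c continuous_intros f g)
  finally show ?thesis .
qed

lemma polynomial_transition_imp_feller:
  assumes poly: "polynomial_transition T S p" and nonempty: "S \<noteq> {}"
  shows "feller T S (transition_op p)"
proof -
  have time_poly: "(\<lambda>s t. transition_op p s t g) \<in> time_polynomials T k S"
    if "g \<in> polynomials k S" for g k
    using poly that by (auto simp: polynomial_transition_def m_polynomial_transition_def)
  have cont_poly: "continuous_on S g" if g: "g \<in> polynomials k S" for g k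
  proof -
    obtain \<alpha> where "\<And>x. x \<in> S \<Longrightarrow> g x = (\<Sum>l | multi_degree l \<le> k. \<alpha> l * monomial l x)"
      using g by (auto simp: polynomials_def)
    moreover have "continuous_on S (\<lambda>x. \<Sum>l | multi_degree l \<le> k. \<alpha> l * monomial l x)"
      by (intro continuous_intros continuous_on_monomial)
    ultimately show ?thesis
      by (simp cong: continuous_on_cong)
  qed
  \<comment> \<open>One polynomial serves all times and all points at once, because the contraction
    bound depends on neither.\<close>
  have approx: "\<exists>g k. g \<in> polynomials k S \<and> (\<forall>v w x. (v, w) \<in> time_simplex T \<longrightarrow> x \<in> S \<longrightarrow>
      \<bar>transition_op p v w f x - transition_op p v w g x\<bar> \<le> e)"
    if f: "continuous_on S f" and "e > 0" for f e
  proof -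
    obtain g k where g: "g \<in> polynomials k S" "\<And>x. x \<in> S \<Longrightarrow> \<bar>f x - g x\<bar> < e"
      using polynomials_dense[OF compact f \<open>e > 0\<close>] by blast
    have "\<bar>transition_op p v w f x - transition_op p v w g x\<bar> \<le> e"
      if "(v, w) \<in> time_simplex T" "x \<in> S" for v w x
      using g(2) by (intro transition_op_diff_le that f cont_poly[OF g(1)]) (auto intro: less_imp_le)
    with g(1) show ?thesis by blast
  qed
  show ?thesis
    unfolding feller_def C0_space_compact[OF compact]
  proof (safe)
    fix f :: "real ^ 'd \<Rightarrow> real" and s t
    assume f: "continuous_on S f" and st: "(s, t) \<in> time_simplex T"
    show "continuous_on S (transition_op p s t f)"
    proof (rule continuous_on_uniform_approx)
      fix e :: real assume "e > 0"
      then obtain g k where g: "g \<in> polynomials k S"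
        "\<forall>x\<in>S. \<bar>transition_op p s t f x - transition_op p s t g x\<bar> \<le> e"
        using approx[OF f] st by meson
      \<comment> \<open>The approximant is \<open>transition_op p s t g\<close>, a polynomial in
        space with coefficients frozen at \<open>(s, t)\<close>.\<close>
      then show "\<exists>h. continuous_on S h \<and> (\<forall>x\<in>S. \<bar>transition_op p s t f x - h x\<bar> \<le> e)"
        using continuous_on_time_polynomial[OF time_poly[OF g(1)] st] by blast
    qed
    show "sup_norm_on S (transition_op p s t f) \<le> sup_norm_on S f"
      using abs_le_sup_norm_on[OF compact f]
      by (intro sup_norm_on_le nonempty transition_op_le st f)
    show "((\<lambda>(v, w). sup_norm_on S (\<lambda>x. transition_op p v w f x - transition_op p s t f x))
        \<longlongrightarrow> 0) (at (s, t) within time_simplex T)"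
    proof (rule tendstoI)
      fix e :: real assume "e > 0"
      \<comment> \<open>Three errors of at most \<open>e / 4\<close> add up to
        \<open>3 * e / 4\<close>. The slack keeps the final inequality strict, since passing to the
        supremum preserves only non-strict bounds.\<close>
      then obtain g k where g: "g \<in> polynomials k S"
        "\<And>v w x. (v, w) \<in> time_simplex T \<Longrightarrow> x \<in> S \<Longrightarrow>
          \<bar>transition_op p v w f x - transition_op p v w g x\<bar> \<le> e / 4"
        using approx[OF f, of "e / 4"] by auto
      have "\<forall>\<^sub>F (v, w) in at (s, t) within time_simplex T.
          \<forall>x\<in>S. \<bar>transition_op p v w g x - transition_op p s t g x\<bar> < e / 4"
        using time_polynomials_uniform[OF compact time_poly[OF g(1)] st, of "e / 4"] \<open>e > 0\<close>
        by simp
      moreover have "\<forall>\<^sub>F z in at (s, t) within time_simplex T. z \<in> time_simplex T"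
        by (simp add: eventually_at_filter)
      ultimately show "\<forall>\<^sub>F z in at (s, t) within time_simplex T. dist
          (case z of (v, w) \<Rightarrow>
            sup_norm_on S (\<lambda>x. transition_op p v w f x - transition_op p s t f x)) 0 < e"
      proof eventually_elim
        case (elim z)
        obtain v w where z: "z = (v, w)" by (cases z)
        let ?d = "\<lambda>x. transition_op p v w f x - transition_op p s t f x"
        \<comment> \<open>The triangle inequality runs through
          \<open>transition_op p v w g x\<close> and \<open>transition_op p s t g x\<close>: two
          approximation errors and one time increment of a polynomial.\<close>
        have bound: "\<bar>?d x\<bar> \<le> 3 * e / 4" if "x \<in> S" for x
        proof -
          have "\<bar>transition_op p v w g x - transition_op p s t g x\<bar> < e / 4"
            using elim(1) that by (auto simp: z)
          then show ?thesis
            using g(2)[OF st that] g(2)[OF elim(2)[unfolded z] that] by linarith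
        qed
        have "sup_norm_on S ?d \<le> 3 * e / 4"
          by (intro sup_norm_on_le nonempty bound)
        \<comment> \<open>The distance to 0 is an absolute value, so the upper bound on the norm
          controls it only together with nonnegativity.\<close>
        moreover have "0 \<le> sup_norm_on S ?d"
        proof -
          obtain x where "x \<in> S" using nonempty by blast
          moreover have "bdd_above ((\<lambda>x. \<bar>?d x\<bar>) ` S)"
            using bound by (rule bdd_aboveI2)
          ultimately have "\<bar>?d x\<bar> \<le> sup_norm_on S ?d"
            unfolding sup_norm_on_def by (rule cSUP_upper)
          then show ?thesis by linarith
        qed
        ultimately show ?case using \<open>e > 0\<close> by (simp add: z)
      qed
    qed
  qed
qed

end

section \<open>Nonempty state space and conclusion\<close>

text \<open>A probability space has a sample point, and the process at time 0 maps it into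
  \<open>S\<close>. This supplies the nonemptiness that bounding a supremum over \<open>S\<close>
  requires.\<close>

lemma markov_process_state_space_nonempty:
  assumes "markov_process T S p M F X" "T > 0"
  shows "S \<noteq> {}"
proof -
  have "prob_space M" "subalgebra M (F 0)" "X 0 \<in> measurable (F 0) (restrict_space borel S)"
    using assms by (auto simp: markov_process_def filtration_on_def)
  then have "X 0 \<in> space M \<rightarrow> S" "space M \<noteq> {}"
    by (auto dest: measurable_space prob_space.not_empty simp: subalgebra_def space_restrict_space)
  then show ?thesis by blast
qed

theorem proposition4p1:
  fixes T :: real
    and S :: "(real ^ 'd::finite) set"
    and p :: "real \<Rightarrow> real \<Rightarrow> real ^ 'd \<Rightarrow> (real ^ 'd) measure"
    and M :: "'w measure"
    and F :: "real \<Rightarrow> 'w measure"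
    and X :: "real \<Rightarrow> 'w \<Rightarrow> real ^ 'd"
  assumes "T > 0"
    and "compact S"
    and "polynomial_process T S p M F X"
  shows "feller T S (transition_op p)"
proof -
  have markov: "markov_process T S p M F X" and "polynomial_transition T S p"
    using assms(3) by (auto simp: polynomial_process_def)
  moreover have "transition_function T S p"
    using markov by (simp add: markov_process_def)
  ultimately show ?thesis
    using assms(1,2) markov_process_state_space_nonempty[OF markov]
    by (intro polynomial_transition_imp_feller)
qed

end
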